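(* Assume $\gamma\in(1,\tfrac53]$, $\phi(p_{\min})<0$ and $\phi(p_{\max})\neq0$. Let $p_2^0:=\tilde p^*$ if $\phi(p_{\max})<0$ and $p_2^0:=\min(p_{\max},\tilde p^* )$ if $\phi(p_{\max})>0$, and set $$v_{11}^0=u_L-a_L\left(1+\tfrac{\gamma+1}{2\gamma}\big(\tfrac{p_2^0-p_L}{p_L}\big)_+\right)^{1/2},\qquad v_{32}^0=u_R+a_R\left(1+\tfrac{\gamma+1}{2\gamma}\big(\tfrac{p_2^0-p_R}{p_R}\big)_+\right)^{1/2}.$$ Then $p_2^0$ is an upper bound on $p^*$ and $$v_{11}^0\le\lambda_1^-<\lambda_3^+\le v_{32}^0.$$ Hence $\lambda_{\max}\le\max\big((v_{11}^0)_-,(v_{32}^0)_+\big)$.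
   Context: Fix $\gamma>1$ and $b\ge 0$. A left state $(\rho_L,u_L,p_L)$ and a right state $(\rho_R,u_R,p_R)$ (density, velocity, pressure) are given with $\rho_L,\rho_R>0$, $1-b\rho_L>0$, $1-b\rho_R>0$, $p_L,p_R>0$ and $u_L,u_R\in\mathbb{R}$. Set $p_{\min}:=\min(p_L,p_R)$, $p_{\max}:=\max(p_L,p_R)$, $z_+:=\max(0,z)$, $z_-:=\max(0,-z)$. For $Z\in\{L,R\}$ let $a_Z:=\sqrt{\frac{\gamma p_Z}{\rho_Z(1-b\rho_Z)}}$, $A_Z:=\frac{2(1-b\rho_Z)}{(\gamma+1)\rho_Z}$, $B_Z:=\frac{\gamma-1}{\gamma+1}p_Z$, and for $p\ge0$ $$f(p,Z):=\begin{cases}(p-p_Z)\left(\frac{A_Z}{p+B_Z}\right)^{1/2}&\text{if }p\ge p_Z,\\ \frac{2a_Z(1-b\rho_Z)}{\gamma-1}\left(\left(\frac{p}{p_Z}\right)^{\frac{\gamma-1}{2\gamma}}-1\right)&\text{if }p<p_Z,\end{cases}\qquad \phi(p):=f(p,L)+f(p,R)+u_R-u_L.$$ The function $\phi$ is strictly increasing and tends to $+\infty$; when $\phi(p_{\min})<0$, $p^*$ denotes its unique positive zero and $\tilde p^*$ denotes the unique zero of $\phi_R(p):=\sum_{Z\in\{L,R\}}\frac{2a_Z(1-b\rho_Z)}{\gamma-1}\left(\left(\frac{p}{p_Z}\right)^{\frac{\gamma-1}{2\gamma}}-1\right)+u_R-u_L$, that is, $$\tilde p^*=\left(\frac{a_L(1-b\rho_L)+a_R(1-b\rho_R)-\frac{\gamma-1}{2}(u_R-u_L)}{a_L(1-b\rho_L)\,p_L^{-\frac{\gamma-1}{2\gamma}}+a_R(1-b\rho_R)\,p_R^{-\frac{\gamma-1}{2\gamma}}}\right)^{\frac{2\gamma}{\gamma-1}}.$$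 The extreme wave speeds of the Riemann problem are $\lambda_1^-:=u_L-a_L\left(1+\frac{\gamma+1}{2\gamma}\left(\frac{p^*-p_L}{p_L}\right)_+\right)^{1/2}$ and $\lambda_3^+:=u_R+a_R\left(1+\frac{\gamma+1}{2\gamma}\left(\frac{p^*-p_R}{p_R}\right)_+\right)^{1/2}$, and the maximum wave speed is $\lambda_{\max}:=\max((\lambda_1^-)_-,(\lambda_3^+)_+)$. *)

theory Defs
  imports Complex_Main
begin

record gas_state =
  dens :: real
  vel :: real
  pres :: real

definition admissible_state :: "real \<Rightarrow> gas_state \<Rightarrow> bool" where
  "admissible_state b Z \<longleftrightarrow> dens Z > 0 \<and> 1 - b * dens Z > 0 \<and> pres Z > 0"

definition pos_part :: "real \<Rightarrow> real" where
  "pos_part z = max 0 z"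

definition neg_part :: "real \<Rightarrow> real" where
  "neg_part z = max 0 (- z)"

definition p_min :: "gas_state \<Rightarrow> gas_state \<Rightarrow> real" where
  "p_min L R = min (pres L) (pres R)"

definition p_max :: "gas_state \<Rightarrow> gas_state \<Rightarrow> real" where
  "p_max L R = max (pres L) (pres R)"

definition sound_speed :: "real \<Rightarrow> real \<Rightarrow> gas_state \<Rightarrow> real" where
  "sound_speed \<gamma> b Z = sqrt (\<gamma> * pres Z / (dens Z * (1 - b * dens Z)))"

definition coeff_A :: "real \<Rightarrow> real \<Rightarrow> gas_state \<Rightarrow> real" where
  "coeff_A \<gamma> b Z = 2 * (1 - b * dens Z) / ((\<gamma> + 1) * dens Z)"

definition coeff_B :: "real \<Rightarrow> gas_state \<Rightarrow> real" where
  "coeff_B \<gamma> Z = (\<gamma> - 1) / (\<gamma> + 1) * pres Z"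

definition f_shock :: "real \<Rightarrow> real \<Rightarrow> gas_state \<Rightarrow> real \<Rightarrow> real" where
  "f_shock \<gamma> b Z p = (p - pres Z) * sqrt (coeff_A \<gamma> b Z / (p + coeff_B \<gamma> Z))"

definition f_rarefaction :: "real \<Rightarrow> real \<Rightarrow> gas_state \<Rightarrow> real \<Rightarrow> real" where
  "f_rarefaction \<gamma> b Z p =
     2 * sound_speed \<gamma> b Z * (1 - b * dens Z) / (\<gamma> - 1)
       * ((p / pres Z) powr ((\<gamma> - 1) / (2 * \<gamma>)) - 1)"

(* Only the values at p >= 0 are meaningful, here and in the functions phi and phi_R. *)
definition f_wave :: "real \<Rightarrow> real \<Rightarrow> gas_state \<Rightarrow> real \<Rightarrow> real" where
  "f_wave \<gamma> b Z p = (if p \<ge> pres Z then f_shock \<gamma> b Z p else f_rarefaction \<gamma> b Z p)"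

definition phi :: "real \<Rightarrow> real \<Rightarrow> gas_state \<Rightarrow> gas_state \<Rightarrow> real \<Rightarrow> real" where
  "phi \<gamma> b L R p = f_wave \<gamma> b L p + f_wave \<gamma> b R p + vel R - vel L"

definition phi_R :: "real \<Rightarrow> real \<Rightarrow> gas_state \<Rightarrow> gas_state \<Rightarrow> real \<Rightarrow> real" where
  "phi_R \<gamma> b L R p = f_rarefaction \<gamma> b L p + f_rarefaction \<gamma> b R p + vel R - vel L"

(* Both zeros exist and are unique when phi is negative at p_min: see the lemmas
   p_star_ex1, p_tilde_ex1 and p_tilde_closed_form below. *)
definition p_star :: "real \<Rightarrow> real \<Rightarrow> gas_state \<Rightarrow> gas_state \<Rightarrow> real" where
  "p_star \<gamma> b L R = (THE p. p > 0 \<and> phi \<gamma> b L R p = 0)"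

definition p_tilde :: "real \<Rightarrow> real \<Rightarrow> gas_state \<Rightarrow> gas_state \<Rightarrow> real" where
  "p_tilde \<gamma> b L R = (THE p. p \<ge> 0 \<and> phi_R \<gamma> b L R p = 0)"

(* Speeds of the outer edge of the 1-wave and of the 3-wave when the intermediate pressure is p. *)
definition speed_1 :: "real \<Rightarrow> real \<Rightarrow> gas_state \<Rightarrow> real \<Rightarrow> real" where
  "speed_1 \<gamma> b L p = vel L - sound_speed \<gamma> b L
     * sqrt (1 + (\<gamma> + 1) / (2 * \<gamma>) * pos_part ((p - pres L) / pres L))"

definition speed_3 :: "real \<Rightarrow> real \<Rightarrow> gas_state \<Rightarrow> real \<Rightarrow> real" where
  "speed_3 \<gamma> b R p = vel R + sound_speed \<gamma> b R
     * sqrt (1 + (\<gamma> + 1) / (2 * \<gamma>) * pos_part ((p - pres R) / pres R))"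

definition lambda_1_minus :: "real \<Rightarrow> real \<Rightarrow> gas_state \<Rightarrow> gas_state \<Rightarrow> real" where
  "lambda_1_minus \<gamma> b L R = speed_1 \<gamma> b L (p_star \<gamma> b L R)"

definition lambda_3_plus :: "real \<Rightarrow> real \<Rightarrow> gas_state \<Rightarrow> gas_state \<Rightarrow> real" where
  "lambda_3_plus \<gamma> b L R = speed_3 \<gamma> b R (p_star \<gamma> b L R)"

definition lambda_max :: "real \<Rightarrow> real \<Rightarrow> gas_state \<Rightarrow> gas_state \<Rightarrow> real" where
  "lambda_max \<gamma> b L R =
     max (neg_part (lambda_1_minus \<gamma> b L R)) (pos_part (lambda_3_plus \<gamma> b L R))"

(* Used only when phi does not vanish at p_max, so the second branch means that it is positive. *)
definition p_2_init :: "real \<Rightarrow> real \<Rightarrow> gas_state \<Rightarrow> gas_state \<Rightarrow> real" where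
  "p_2_init \<gamma> b L R =
     (if phi \<gamma> b L R (p_max L R) < 0 then p_tilde \<gamma> b L R
      else min (p_max L R) (p_tilde \<gamma> b L R))"

definition v_11_init :: "real \<Rightarrow> real \<Rightarrow> gas_state \<Rightarrow> gas_state \<Rightarrow> real" where
  "v_11_init \<gamma> b L R = speed_1 \<gamma> b L (p_2_init \<gamma> b L R)"

definition v_32_init :: "real \<Rightarrow> real \<Rightarrow> gas_state \<Rightarrow> gas_state \<Rightarrow> real" where
  "v_32_init \<gamma> b L R = speed_3 \<gamma> b R (p_2_init \<gamma> b L R)"


lemma sound_speed_pos:
  assumes "\<gamma> > 1" "admissible_state b Z"
  shows "sound_speed \<gamma> b Z > 0"
  using assms by (simp add: sound_speed_def admissible_state_def)

lemma f_rarefaction_less: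
  assumes "\<gamma> > 1" "admissible_state b Z" "0 \<le> p" "p < q"
  shows "f_rarefaction \<gamma> b Z p < f_rarefaction \<gamma> b Z q"
proof -
  have pz: "pres Z > 0" "1 - b * dens Z > 0" using assms by (auto simp: admissible_state_def)
  have "0 \<le> p / pres Z" "p / pres Z < q / pres Z"
    using pz assms by (auto simp: divide_strict_right_mono)
  then have "(p / pres Z) powr ((\<gamma> - 1) / (2 * \<gamma>)) < (q / pres Z) powr ((\<gamma> - 1) / (2 * \<gamma>))"
    using assms(1) by (intro powr_less_mono2) auto
  moreover have "2 * sound_speed \<gamma> b Z * (1 - b * dens Z) / (\<gamma> - 1) > 0"
    using sound_speed_pos[OF assms(1,2)] pz assms(1) by simp
  ultimately show ?thesis unfolding f_rarefaction_def
    by (intro mult_strict_left_mono) auto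
qed

lemma f_shock_form:
  assumes "\<gamma> > 1" "admissible_state b Z" "p \<ge> pres Z"
  shows "f_shock \<gamma> b Z p = sqrt (coeff_A \<gamma> b Z) *
     (sqrt (p + coeff_B \<gamma> Z) - (pres Z + coeff_B \<gamma> Z) / sqrt (p + coeff_B \<gamma> Z))"
    and "pres Z + coeff_B \<gamma> Z > 0" and "coeff_A \<gamma> b Z > 0"
proof -
  have pz: "pres Z > 0" using assms by (auto simp: admissible_state_def)
  have B: "coeff_B \<gamma> Z > 0" using pz assms(1) by (simp add: coeff_B_def)
  show "pres Z + coeff_B \<gamma> Z > 0" using B pz by simp
  show "coeff_A \<gamma> b Z > 0" using assms by (simp add: coeff_A_def admissible_state_def)
  have pos: "p + coeff_B \<gamma> Z > 0" using B pz assms by simp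
  define s where "s = sqrt (p + coeff_B \<gamma> Z)"
  have s: "s > 0" "s * s = p + coeff_B \<gamma> Z" using pos by (simp_all add: s_def)
  have "p - pres Z = s * s - (pres Z + coeff_B \<gamma> Z)" using s by simp
  then have "f_shock \<gamma> b Z p = (s * s - (pres Z + coeff_B \<gamma> Z)) * (sqrt (coeff_A \<gamma> b Z) / s)"
    by (simp add: f_shock_def real_sqrt_divide s_def)
  also have "\<dots> = sqrt (coeff_A \<gamma> b Z) * (s - (pres Z + coeff_B \<gamma> Z) / s)"
    using s(1) by (simp add: field_simps)
  finally show "f_shock \<gamma> b Z p = sqrt (coeff_A \<gamma> b Z) *
     (sqrt (p + coeff_B \<gamma> Z) - (pres Z + coeff_B \<gamma> Z) / sqrt (p + coeff_B \<gamma> Z))"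
    by (simp add: s_def)
qed

lemma f_shock_less:
  assumes "\<gamma> > 1" "admissible_state b Z" "pres Z \<le> p" "p < q"
  shows "f_shock \<gamma> b Z p < f_shock \<gamma> b Z q"
proof -
  note c = f_shock_form(2,3)[OF assms(1-3)]
  define s t where "s = sqrt (p + coeff_B \<gamma> Z)" and "t = sqrt (q + coeff_B \<gamma> Z)"
  have st: "0 < s" "s < t" using c assms by (auto simp: s_def t_def)
  have "(pres Z + coeff_B \<gamma> Z) / t < (pres Z + coeff_B \<gamma> Z) / s"
    using st c by (intro divide_strict_left_mono) auto
  then have "s - (pres Z + coeff_B \<gamma> Z) / s < t - (pres Z + coeff_B \<gamma> Z) / t"
    using st by linarith
  then show ?thesis
    using c assms by (simp add: f_shock_form(1)[OF assms(1,2)] s_def t_def)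
qed

lemma f_at_pres:
  assumes "admissible_state b Z"
  shows "f_shock \<gamma> b Z (pres Z) = 0" "f_rarefaction \<gamma> b Z (pres Z) = 0"
  using assms by (auto simp: f_shock_def f_rarefaction_def admissible_state_def)

lemma f_wave_less:
  assumes "\<gamma> > 1" "admissible_state b Z" "0 \<le> p" "p < q"
  shows "f_wave \<gamma> b Z p < f_wave \<gamma> b Z q"
proof -
  consider "q < pres Z" | "p < pres Z" "q = pres Z" | "p < pres Z" "pres Z < q" | "pres Z \<le> p"
    by linarith
  then show ?thesis
  proof cases
    case 3
    have "f_rarefaction \<gamma> b Z p < 0"
      using f_rarefaction_less[OF assms(1-3) 3(1)] f_at_pres[OF assms(2)] by simp
    moreover have "0 < f_shock \<gamma> b Z q"
      using f_shock_less[OF assms(1,2) _ 3(2)] f_at_pres[OF assms(2)] by simp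
    ultimately show ?thesis using 3 by (simp add: f_wave_def)
  qed (use assms f_rarefaction_less[OF assms] f_shock_less[OF assms(1,2) _ assms(4)]
        f_at_pres[OF assms(2)] in \<open>auto simp: f_wave_def\<close>)
qed

lemma f_wave_split:
  assumes "admissible_state b Z"
  shows "f_wave \<gamma> b Z p = f_shock \<gamma> b Z (max p (pres Z)) + f_rarefaction \<gamma> b Z (min p (pres Z))"
  using f_at_pres[OF assms] by (auto simp: f_wave_def max_def min_def)

lemma continuous_on_f_rarefaction:
  assumes "\<gamma> > 1" "admissible_state b Z"
  shows "continuous_on {0..} (f_rarefaction \<gamma> b Z)"
  unfolding f_rarefaction_def
  using assms by (intro continuous_intros continuous_on_powr') (auto simp: admissible_state_def)

lemma continuous_on_f_wave:
  assumes "\<gamma> > 1" "admissible_state b Z"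
  shows "continuous_on {0..} (f_wave \<gamma> b Z)"
proof -
  have pz: "pres Z > 0" using assms by (simp add: admissible_state_def)
  have B: "coeff_B \<gamma> Z > 0" using pz assms(1) by (simp add: coeff_B_def)
  have "continuous_on {pres Z..} (f_shock \<gamma> b Z)"
    unfolding f_shock_def using pz B
    by (intro continuous_intros) auto
  then have "continuous_on {0..} (\<lambda>p. f_shock \<gamma> b Z (max p (pres Z)))"
    by (rule continuous_on_compose2) (auto intro!: continuous_intros)
  moreover have "continuous_on {0..} (\<lambda>p. f_rarefaction \<gamma> b Z (min p (pres Z)))"
    using pz by (intro continuous_on_compose2[OF continuous_on_f_rarefaction[OF assms]])
      (auto intro!: continuous_intros)
  ultimately show ?thesis
    unfolding f_wave_split[OF assms(2), abs_def] by (rule continuous_on_add)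
qed

lemma f_wave_unbounded:
  assumes "\<gamma> > 1" "admissible_state b Z" "K > 0"
  shows "\<exists>q \<ge> pres Z. \<forall>p \<ge> q. f_wave \<gamma> b Z p \<ge> K"
proof -
  have pz: "pres Z > 0" using assms by (simp add: admissible_state_def)
  define c A where "c = pres Z + coeff_B \<gamma> Z" and "A = coeff_A \<gamma> b Z"
  have c: "c > 0" "A > 0"
    using f_shock_form(2,3)[OF assms(1,2) order.refl] by (simp_all add: c_def A_def)
  define s where "s = sqrt c + K / sqrt A"
  have s: "s \<ge> sqrt c" "s > 0" using c assms by (simp_all add: s_def add_pos_pos)
  define q where "q = s\<^sup>2 - coeff_B \<gamma> Z"
  have "(sqrt c)\<^sup>2 \<le> s\<^sup>2" using s c by (intro power_mono) auto
  then have q: "q \<ge> pres Z" using c by (simp add: q_def c_def)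
  have "f_wave \<gamma> b Z p \<ge> K" if "p \<ge> q" for p
  proof -
    define r where "r = sqrt (p + coeff_B \<gamma> Z)"
    have "s\<^sup>2 \<le> p + coeff_B \<gamma> Z" using that by (simp add: q_def)
    then have r: "r \<ge> s" unfolding r_def by (rule real_le_rsqrt)
    have "c / r \<le> c / sqrt c" using r s c by (intro divide_left_mono) auto
    also have "\<dots> = sqrt c" using c by (simp add: real_div_sqrt)
    finally have "r - c / r \<ge> K / sqrt A" using r by (simp add: s_def)
    then have "sqrt A * (K / sqrt A) \<le> sqrt A * (r - c / r)"
      using c by (intro mult_left_mono) auto
    then show ?thesis
      using c that q f_shock_form(1)[OF assms(1,2), of p]
      by (simp add: f_wave_def r_def c_def A_def)
  qed
  then show ?thesis using q by blast
qed

lemma zero_ex1_above: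
  fixes g :: "real \<Rightarrow> real"
  assumes "continuous_on {0..} g" and mono: "\<And>p q. 0 \<le> p \<Longrightarrow> p < q \<Longrightarrow> g p < g q"
    and "0 < m" "g m < 0" "m \<le> q" "g q \<ge> 0"
  shows "\<exists>!p. p > 0 \<and> g p = 0"
proof -
  have "continuous_on {m..q} g"
    using assms(1) by (rule continuous_on_subset) (use assms in auto)
  then obtain x where x: "m \<le> x" "g x = 0"
    using IVT'[of g m 0 q] assms by auto
  show ?thesis
  proof (intro ex1I[of _ x] conjI)
    show "y = x" if "y > 0 \<and> g y = 0" for y
      using mono[of x y] mono[of y x] that x \<open>0 < m\<close> by (cases x y rule: linorder_cases) auto
  qed (use x \<open>0 < m\<close> in auto)
qed

lemma p_star_ex1:
  assumes "\<gamma> > 1" "admissible_state b L" "admissible_state b R"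
    and "phi \<gamma> b L R (p_min L R) < 0"
  shows "\<exists>!p. p > 0 \<and> phi \<gamma> b L R p = 0"
proof -
  obtain qL qR where q: "qL \<ge> pres L" "\<And>p. p \<ge> qL \<Longrightarrow> f_wave \<gamma> b L p \<ge> \<bar>vel R - vel L\<bar> + 1"
      "\<And>p. p \<ge> qR \<Longrightarrow> f_wave \<gamma> b R p \<ge> 1"
    using f_wave_unbounded[OF assms(1,2), of "\<bar>vel R - vel L\<bar> + 1"]
      f_wave_unbounded[OF assms(1,3), of 1] by fastforce
  show ?thesis
  proof (rule zero_ex1_above[of _ "p_min L R" "max qL qR"])
    show "continuous_on {0..} (phi \<gamma> b L R)"
      unfolding phi_def[abs_def]
      by (intro continuous_intros continuous_on_f_wave assms)
    show "phi \<gamma> b L R p < phi \<gamma> b L R q" if "0 \<le> p" "p < q" for p q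
      using f_wave_less[OF assms(1,2) that] f_wave_less[OF assms(1,3) that]
      by (simp add: phi_def)
    show "0 < p_min L R" using assms by (simp add: p_min_def admissible_state_def)
    show "p_min L R \<le> max qL qR" using q by (simp add: p_min_def)
    show "phi \<gamma> b L R (max qL qR) \<ge> 0"
      using q(2)[of "max qL qR"] q(3)[of "max qL qR"] by (simp add: phi_def)
  qed (fact assms)
qed

definition p_tilde_formula :: "real \<Rightarrow> real \<Rightarrow> gas_state \<Rightarrow> gas_state \<Rightarrow> real" where
  "p_tilde_formula \<gamma> b L R =
     ((sound_speed \<gamma> b L * (1 - b * dens L) + sound_speed \<gamma> b R * (1 - b * dens R)
         - (\<gamma> - 1) / 2 * (vel R - vel L))
      / (sound_speed \<gamma> b L * (1 - b * dens L) * pres L powr (- ((\<gamma> - 1) / (2 * \<gamma>)))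
         + sound_speed \<gamma> b R * (1 - b * dens R) * pres R powr (- ((\<gamma> - 1) / (2 * \<gamma>)))))
     powr (2 * \<gamma> / (\<gamma> - 1))"

lemma phi_R_alt:
  assumes "\<gamma> > 1" "admissible_state b L" "admissible_state b R" "p \<ge> 0"
  shows "phi_R \<gamma> b L R p = 2 / (\<gamma> - 1) *
     (p powr ((\<gamma> - 1) / (2 * \<gamma>))
        * (sound_speed \<gamma> b L * (1 - b * dens L) * pres L powr (- ((\<gamma> - 1) / (2 * \<gamma>)))
           + sound_speed \<gamma> b R * (1 - b * dens R) * pres R powr (- ((\<gamma> - 1) / (2 * \<gamma>))))
      - (sound_speed \<gamma> b L * (1 - b * dens L) + sound_speed \<gamma> b R * (1 - b * dens R)
         - (\<gamma> - 1) / 2 * (vel R - vel L)))"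
proof -
  define e where "e = (\<gamma> - 1) / (2 * \<gamma>)"
  define cL cR where "cL = sound_speed \<gamma> b L * (1 - b * dens L)"
    and "cR = sound_speed \<gamma> b R * (1 - b * dens R)"
  have pw: "(p / pres Z) powr e = p powr e * pres Z powr (- e)" if "admissible_state b Z" for Z
    using that assms(4) by (simp add: powr_divide powr_minus admissible_state_def field_simps)
  have fr: "f_rarefaction \<gamma> b Z p = 2 / (\<gamma> - 1) * (sound_speed \<gamma> b Z * (1 - b * dens Z)
      * (p powr e * pres Z powr (- e) - 1))" if "admissible_state b Z" for Z
    unfolding f_rarefaction_def e_def[symmetric] pw[OF that] by simp
  have "vel R - vel L = 2 / (\<gamma> - 1) * ((\<gamma> - 1) / 2 * (vel R - vel L))"
    using assms(1) by simp
  then have "phi_R \<gamma> b L R p = 2 / (\<gamma> - 1) * (cL * (p powr e * pres L powr (- e) - 1))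
     + 2 / (\<gamma> - 1) * (cR * (p powr e * pres R powr (- e) - 1))
     + 2 / (\<gamma> - 1) * ((\<gamma> - 1) / 2 * (vel R - vel L))"
    unfolding phi_R_def fr[OF assms(2)] fr[OF assms(3)] cL_def cR_def by linarith
  also have "\<dots> = 2 / (\<gamma> - 1) * (cL * (p powr e * pres L powr (- e) - 1)
     + cR * (p powr e * pres R powr (- e) - 1) + (\<gamma> - 1) / 2 * (vel R - vel L))"
    by (simp only: distrib_left)
  also have "cL * (p powr e * pres L powr (- e) - 1)
     + cR * (p powr e * pres R powr (- e) - 1) + (\<gamma> - 1) / 2 * (vel R - vel L)
     = p powr e * (cL * pres L powr (- e) + cR * pres R powr (- e))
       - (cL + cR - (\<gamma> - 1) / 2 * (vel R - vel L))"
    by (simp add: algebra_simps)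
  finally show ?thesis unfolding cL_def cR_def e_def .
qed

lemma phi_R_less:
  assumes "\<gamma> > 1" "admissible_state b L" "admissible_state b R" "0 \<le> p" "p < q"
  shows "phi_R \<gamma> b L R p < phi_R \<gamma> b L R q"
  using f_rarefaction_less[OF assms(1,2,4,5)] f_rarefaction_less[OF assms(1,3,4,5)]
  by (simp add: phi_R_def)

lemma p_tilde_formula_zero:
  assumes "\<gamma> > 1" "admissible_state b L" "admissible_state b R"
    and "phi \<gamma> b L R (p_min L R) < 0"
  shows "p_tilde_formula \<gamma> b L R \<ge> 0" "phi_R \<gamma> b L R (p_tilde_formula \<gamma> b L R) = 0"
proof -
  define e where "e = (\<gamma> - 1) / (2 * \<gamma>)"
  define N where "N = sound_speed \<gamma> b L * (1 - b * dens L) + sound_speed \<gamma> b R * (1 - b * dens R)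
         - (\<gamma> - 1) / 2 * (vel R - vel L)"
  define D where "D = sound_speed \<gamma> b L * (1 - b * dens L) * pres L powr (- e)
           + sound_speed \<gamma> b R * (1 - b * dens R) * pres R powr (- e)"
  have e: "e > 0" "2 * \<gamma> / (\<gamma> - 1) = inverse e" using assms(1) by (simp_all add: e_def)
  have pz: "pres L > 0" "pres R > 0" "1 - b * dens L > 0" "1 - b * dens R > 0"
    using assms by (auto simp: admissible_state_def)
  have D: "D > 0" unfolding D_def
    using pz sound_speed_pos[OF assms(1,2)] sound_speed_pos[OF assms(1,3)]
    by (intro add_pos_pos mult_pos_pos) auto
  have m: "p_min L R > 0" using pz by (simp add: p_min_def)
  have alt: "phi_R \<gamma> b L R p = 2 / (\<gamma> - 1) * (p powr e * D - N)" if "p \<ge> 0" for p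
    using phi_R_alt[OF assms(1-3) that] by (simp add: e_def D_def N_def)
  have "phi_R \<gamma> b L R (p_min L R) = phi \<gamma> b L R (p_min L R)"
    using f_at_pres[OF assms(2)] f_at_pres[OF assms(3)]
    by (auto simp: phi_def phi_R_def f_wave_def p_min_def min_def)
  then have "2 / (\<gamma> - 1) * (p_min L R powr e * D - N) < 0"
    using alt[of "p_min L R"] m assms(4) by simp
  moreover have "2 / (\<gamma> - 1) > 0" using assms(1) by simp
  ultimately have "p_min L R powr e * D < N"
    unfolding mult_less_0_iff by linarith
  moreover have "0 < p_min L R powr e * D" using m D by simp
  ultimately have N: "N > 0" by linarith
  have eq: "p_tilde_formula \<gamma> b L R = (N / D) powr inverse e"
    unfolding p_tilde_formula_def e(2) N_def D_def e_def ..
  show "p_tilde_formula \<gamma> b L R \<ge> 0" by (simp add: eq)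
  have "p_tilde_formula \<gamma> b L R powr e = N / D"
    using N D e(1) by (simp add: eq powr_powr)
  then show "phi_R \<gamma> b L R (p_tilde_formula \<gamma> b L R) = 0"
    using D by (simp add: alt eq)
qed

lemma p_tilde_ex1:
  assumes "\<gamma> > 1" "admissible_state b L" "admissible_state b R"
    and "phi \<gamma> b L R (p_min L R) < 0"
  shows "\<exists>!p. p \<ge> 0 \<and> phi_R \<gamma> b L R p = 0"
proof (intro ex1I[of _ "p_tilde_formula \<gamma> b L R"] conjI)
  show "y = p_tilde_formula \<gamma> b L R" if "y \<ge> 0 \<and> phi_R \<gamma> b L R y = 0" for y
    using p_tilde_formula_zero[OF assms] that
      phi_R_less[OF assms(1-3), of y "p_tilde_formula \<gamma> b L R"]
      phi_R_less[OF assms(1-3), of "p_tilde_formula \<gamma> b L R" y]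
    by (cases y "p_tilde_formula \<gamma> b L R" rule: linorder_cases) auto
qed (use p_tilde_formula_zero[OF assms] in auto)

lemma p_tilde_closed_form:
  assumes "\<gamma> > 1" "admissible_state b L" "admissible_state b R"
    and "phi \<gamma> b L R (p_min L R) < 0"
  shows "p_tilde \<gamma> b L R = p_tilde_formula \<gamma> b L R"
  unfolding p_tilde_def using p_tilde_ex1[OF assms] p_tilde_formula_zero[OF assms]
  by (intro the1_equality) auto

end

theory Submission
  imports Defs
begin

text \<open>
  The whole statement rests on the inequality \<open>f_rarefaction \<le> f_wave\<close>: continuing a rarefaction
  curve beyond the state \<open>Z\<close>, where a shock should take over, underestimates the velocity jump
  (\<open>f_rarefaction_le_f_wave\<close>).  Hence \<open>phi_R \<le> phi\<close>, so the zero of \<open>phi_R\<close> lies to the right of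
  the zero of the increasing function \<open>phi\<close>.  If \<open>phi\<close> is positive at the larger of the two
  pressures, that pressure also bounds the zero from above.  The bounds on the wave speeds follow,
  since the speeds are monotone in the intermediate pressure.

  With \<open>x = p / pres Z\<close> and \<open>e = (\<gamma> - 1) / (2 * \<gamma>)\<close> the key inequality for \<open>x \<ge> 1\<close> becomes
  \<open>(x powr e - 1) / e \<le> (x - 1) / sqrt w\<close> with \<open>w = (1 - e) * x + e\<close>.  The two sides agree up to
  second order at \<open>x = 1\<close>, and the third-order terms are ordered correctly if and only if
  \<open>e \<le> 1 / 5\<close>, that is \<open>\<gamma> \<le> 5 / 3\<close>.  Comparing first the derivatives, and then the derivatives of
  the logarithms of those, reduces the claim to a polynomial that is visibly nonnegative for such
  \<open>e\<close> (\<open>rarefaction_le_shock_profile\<close>).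

  The strict inequality between the extreme speeds is a separate fact.  For \<open>x \<ge> 1\<close> the same \<open>w\<close>
  is the quantity under the square root in the speeds, and \<open>f_wave\<close> is always smaller than the
  sound speed times that square root (\<open>f_wave_less_speed\<close>).  At the zero of \<open>phi\<close> the two values of
  \<open>f_wave\<close> add up to \<open>vel L - vel R\<close>, so the gap between the speeds is positive.
\<close>

section \<open>Rarefaction and shock curves in normalized form\<close>

text \<open>
  This compares the derivatives of the two normalized curves: \<open>x powr (e - 1)\<close>, and on the right
  that of \<open>(x - 1) / sqrt w\<close>, where \<open>w = (1 - e) * x + e\<close>, both multiplied by
  \<open>x powr (1 - e) * w powr (3 / 2)\<close> before taking logarithms.  The difference vanishes at \<open>x = 1\<close>.
  With \<open>t = x - 1\<close> and \<open>k = 1 - e\<close> its derivative has the sign of \<open>(2 * k\<^sup>2 - k) * t\<^sup>2 + (5 * k - 4) * t\<close>, and \<open>5 * k - 4 \<ge> 0\<close> is the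
  hypothesis on \<open>e\<close>.
\<close>
lemma ln_slope_comparison:
  fixes e x :: real
  assumes "0 < e" "e \<le> 1 / 5" "1 \<le> x"
  shows "3 / 2 * ln ((1 - e) * x + e) \<le> ln (((1 - e) * x + e + 1) / 2) + (1 - e) * ln x"
proof -
  define H where
    "H x = ln (((1 - e) * x + e + 1) / 2) - 3 / 2 * ln ((1 - e) * x + e) + (1 - e) * ln x" for x
  have "H 1 \<le> H x"
  proof (rule DERIV_nonneg_imp_nondecreasing[OF assms(3)])
    fix y :: real assume "1 \<le> y"
    define w where "w = (1 - e) * y + e"
    have w: "w > 0" using assms \<open>1 \<le> y\<close> by (simp add: w_def add_pos_pos)
    define D where "D = (1 - e) / (w + 1) - 3 / 2 * ((1 - e) / w) + (1 - e) / y"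
    have dw: "((\<lambda>x. (1 - e) * x + e) has_real_derivative 1 - e) (at y)"
      by (auto intro!: derivative_eq_intros)
    have dw1: "((\<lambda>x. ((1 - e) * x + e + 1) / 2) has_real_derivative (1 - e) / 2) (at y)"
      using DERIV_cdivide[OF DERIV_add[OF dw DERIV_const[of 1]]] by simp
    have "(H has_real_derivative
        1 / ((w + 1) / 2) * ((1 - e) / 2) - 3 / 2 * (1 / w * (1 - e)) + (1 - e) * (1 / y)) (at y)"
      unfolding H_def[abs_def] w_def
      by (intro DERIV_add DERIV_diff DERIV_cmult DERIV_chain2[OF DERIV_ln_divide dw1]
          DERIV_chain2[OF DERIV_ln_divide dw] DERIV_ln_divide)
        (use w \<open>1 \<le> y\<close> in \<open>simp_all add: w_def\<close>)
    also have "1 / ((w + 1) / 2) * ((1 - e) / 2) - 3 / 2 * (1 / w * (1 - e)) + (1 - e) * (1 / y) = D"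
    proof -
      have "1 / (a / 2) * (c / 2) = c / a" for a c :: real by simp
      from this[of "w + 1" "1 - e"] show ?thesis unfolding D_def by simp
    qed
    finally have "(H has_real_derivative D) (at y)" .
    moreover have "D \<ge> 0"
    proof -
      define k t where "k = 1 - e" and "t = y - 1"
      have kt: "k \<ge> 4 / 5" "t \<ge> 0" using assms \<open>1 \<le> y\<close> by (auto simp: k_def t_def)
      have wt: "w = k * t + 1" by (simp add: w_def k_def t_def algebra_simps)
      have "D = k * (2 * w * y - 3 * y * (w + 1) + 2 * w * (w + 1)) / (2 * w * y * (w + 1))"
      proof -
        have "1 / v - 3 / 2 * (1 / w) + 1 / y = (2 * w * y - 3 * y * v + 2 * w * v) / (2 * w * y * v)"
          if "v > 0" for v using that w \<open>1 \<le> y\<close> by (simp add: field_simps)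
        moreover have "D = k * (1 / (w + 1) - 3 / 2 * (1 / w) + 1 / y)"
          unfolding D_def k_def distrib_left right_diff_distrib by simp
        ultimately show ?thesis using w by simp
      qed
      also have "2 * w * y - 3 * y * (w + 1) + 2 * w * (w + 1)
          = k * (2 * k - 1) * t\<^sup>2 + (5 * k - 4) * t"
        unfolding wt by (simp add: t_def power2_eq_square algebra_simps)
      finally show ?thesis using kt w \<open>1 \<le> y\<close> by simp
    qed
    ultimately show "\<exists>D. (H has_real_derivative D) (at y) \<and> D \<ge> 0" by blast
  qed
  then show ?thesis by (simp add: H_def)
qed

text \<open>Both sides vanish at \<open>x = 1\<close>; \<open>ln_slope_comparison\<close> orders their derivatives.\<close>
lemma rarefaction_le_shock_profile:
  fixes e x :: real
  assumes "0 < e" "e \<le> 1 / 5" "1 \<le> x"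
  shows "(x powr e - 1) / e \<le> (x - 1) / sqrt ((1 - e) * x + e)"
proof -
  define G where "G x = (x - 1) / sqrt ((1 - e) * x + e) - (x powr e - 1) / e" for x
  have "G 1 \<le> G x"
  proof (rule DERIV_nonneg_imp_nondecreasing[OF assms(3)])
    fix y :: real assume y: "1 \<le> y"
    define w where "w = (1 - e) * y + e"
    have w: "w > 0" using assms y by (simp add: w_def add_pos_pos)
    define s where "s = sqrt w"
    have s: "s > 0" "s * s = w" using w by (simp_all add: s_def)
    have dw: "((\<lambda>x. (1 - e) * x + e) has_real_derivative 1 - e) (at y)"
      by (auto intro!: derivative_eq_intros)
    have ds: "((\<lambda>x. sqrt ((1 - e) * x + e)) has_real_derivative (1 - e) / (2 * s)) (at y)"
    proof -
      have "((\<lambda>x. sqrt ((1 - e) * x + e)) has_real_derivative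
          inverse (sqrt ((1 - e) * y + e)) / 2 * (1 - e)) (at y)"
        using w unfolding w_def by (intro DERIV_chain2[OF DERIV_real_sqrt dw])
      then show ?thesis
        unfolding s_def w_def by (simp only: divide_inverse inverse_mult_distrib ac_simps)
    qed
    have d1: "((\<lambda>x. x - 1) has_real_derivative 1) (at y)"
      by (auto intro!: derivative_eq_intros)
    have dq: "((\<lambda>x. (x - 1) / sqrt ((1 - e) * x + e)) has_real_derivative
        (1 * s - (y - 1) * ((1 - e) / (2 * s))) / (s * s)) (at y)"
      using DERIV_divide[OF d1 ds] s(1) by (simp add: s_def w_def)
    have dr: "((\<lambda>x. (x powr e - 1) / e) has_real_derivative y powr (e - 1)) (at y)"
      using DERIV_cdivide[OF DERIV_diff[OF has_real_derivative_powr[of y e] DERIV_const[of 1]], of e]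
        y assms(1) by simp
    have "(G has_real_derivative
        (1 * s - (y - 1) * ((1 - e) / (2 * s))) / (s * s) - y powr (e - 1)) (at y)"
      unfolding G_def[abs_def] by (rule DERIV_diff[OF dq dr])
    also have "(1 * s - (y - 1) * ((1 - e) / (2 * s))) / (s * s)
        = (2 * (s * s) - (y - 1) * (1 - e)) / (2 * s * (s * s))"
      using s(1) by (simp add: field_simps)
    also have "\<dots> = ((w + 1) / 2) / (s * w)"
      unfolding s(2) using w s(1) by (simp add: w_def field_simps)
    also have "\<dots> = ((w + 1) / 2) / w powr (3 / 2)"
    proof -
      have "w powr (3 / 2) = w powr (1 / 2) * w powr 1"
        unfolding powr_add[symmetric] by simp
      then show ?thesis using w by (simp add: s_def powr_half_sqrt)
    qed
    finally have "(G has_real_derivative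
        ((w + 1) / 2) / w powr (3 / 2) - y powr (e - 1)) (at y)" .
    moreover have "y powr (e - 1) \<le> ((w + 1) / 2) / w powr (3 / 2)"
    proof -
      have "ln (y powr (e - 1)) \<le> ln (((w + 1) / 2) / w powr (3 / 2))"
      proof -
        have "ln (((w + 1) / 2) / w powr (3 / 2)) = ln ((w + 1) / 2) - 3 / 2 * ln w"
          using w ln_divide_pos[of "(w + 1) / 2" "w powr (3 / 2)"] by (simp only: ln_powr) simp
        moreover have "ln (y powr (e - 1)) = - ((1 - e) * ln y)"
          using y by (simp add: ln_powr algebra_simps)
        ultimately show ?thesis
          using ln_slope_comparison[OF assms(1,2) y] unfolding w_def[symmetric] by linarith
      qed
      then show ?thesis using w y by (subst (asm) ln_le_cancel_iff) auto
    qed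
    ultimately show "\<exists>D. (G has_real_derivative D) (at y) \<and> D \<ge> 0"
      by (intro exI conjI) auto
  qed
  then show ?thesis by (simp add: G_def)
qed

text \<open>
  The radicand is the one occurring in the wave speeds; writing it with the exponent of the
  rarefaction curve puts both curves and the speeds into the same variables.
\<close>
lemma f_shock_normalized:
  assumes "\<gamma> > 1" "admissible_state b Z" "p \<ge> pres Z"
  defines "e \<equiv> (\<gamma> - 1) / (2 * \<gamma>)" and "x \<equiv> p / pres Z"
  shows "f_shock \<gamma> b Z p =
    sound_speed \<gamma> b Z * (1 - b * dens Z) / \<gamma> * ((x - 1) / sqrt ((1 - e) * x + e))"
proof -
  define q r c where "q = pres Z" and "r = dens Z" and "c = 1 - b * dens Z"
  have pos: "q > 0" "r > 0" "c > 0" "p > 0"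
    using assms by (auto simp: admissible_state_def q_def r_def c_def)
  define w where "w = (1 - e) * x + e"
  have w: "2 * \<gamma> * q * w = (\<gamma> + 1) * p + (\<gamma> - 1) * q"
    using pos assms(1) by (simp add: w_def e_def x_def q_def field_simps)
  have "(\<gamma> + 1) * p + (\<gamma> - 1) * q > 0" using pos assms(1) by (simp add: add_pos_pos)
  with w have w_pos: "w > 0"
    using pos assms(1)
    by (metis mult_pos_pos zero_less_mult_pos zero_less_numeral less_trans zero_less_one)
  have "p + coeff_B \<gamma> Z = 2 * \<gamma> * q * w / (\<gamma> + 1)"
    unfolding w using assms(1) by (simp add: coeff_B_def q_def field_simps)
  then have "coeff_A \<gamma> b Z / (p + coeff_B \<gamma> Z)
      = 2 * c / ((\<gamma> + 1) * r) / (2 * \<gamma> * q * w / (\<gamma> + 1))"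
    by (simp only: coeff_A_def c_def r_def)
  also have "\<dots> = c / (r * \<gamma> * q * w)" using assms(1) by simp
  also have "\<dots> = (\<gamma> * q / (r * c)) * (c / (\<gamma> * q))\<^sup>2 / w"
    using assms(1) pos w_pos by (simp add: field_simps power2_eq_square)
  finally have "sqrt (coeff_A \<gamma> b Z / (p + coeff_B \<gamma> Z))
      = sound_speed \<gamma> b Z * (c / (\<gamma> * q)) / sqrt w"
    using assms(1) pos
    by (simp add: real_sqrt_mult real_sqrt_divide sound_speed_def q_def r_def c_def)
  moreover have "p - q = q * (x - 1)" using pos by (simp add: x_def q_def field_simps)
  ultimately have "f_shock \<gamma> b Z p
      = q * (x - 1) * (sound_speed \<gamma> b Z * (c / (\<gamma> * q)) / sqrt w)"
    by (simp add: f_shock_def q_def)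
  also have "\<dots> = sound_speed \<gamma> b Z * c / \<gamma> * ((x - 1) / sqrt w)"
    using pos by simp
  finally show ?thesis by (simp add: c_def w_def)
qed

lemma f_rarefaction_le_f_wave:
  assumes "1 < \<gamma>" "\<gamma> \<le> 5 / 3" "admissible_state b Z"
  shows "f_rarefaction \<gamma> b Z p \<le> f_wave \<gamma> b Z p"
proof (cases "p \<ge> pres Z")
  case True
  define e x where "e = (\<gamma> - 1) / (2 * \<gamma>)" and "x = p / pres Z"
  define C where "C = sound_speed \<gamma> b Z * (1 - b * dens Z) / \<gamma>"
  have e: "0 < e" "e \<le> 1 / 5" using assms by (auto simp: e_def field_simps)
  have x: "1 \<le> x" using True assms(3) by (simp add: x_def admissible_state_def)
  have C: "C \<ge> 0"
    using sound_speed_pos[OF assms(1,3)] assms by (simp add: C_def admissible_state_def)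
  have "f_rarefaction \<gamma> b Z p = C * ((x powr e - 1) / e)"
    unfolding f_rarefaction_def C_def e_def[symmetric] x_def[symmetric]
    using assms(1) by (simp add: e_def)
  also have "\<dots> \<le> C * ((x - 1) / sqrt ((1 - e) * x + e))"
    using rarefaction_le_shock_profile[OF e x] C by (rule mult_left_mono)
  also have "\<dots> = f_wave \<gamma> b Z p"
    using f_shock_normalized[OF assms(1,3) True] True
    by (simp add: f_wave_def C_def e_def x_def)
  finally show ?thesis .
qed (simp add: f_wave_def)

section \<open>Velocity jump against wave speed\<close>

text \<open>
  On the rarefaction branch the jump is negative.  On the shock branch, with \<open>x\<close>, \<open>e\<close> and \<open>w\<close> as
  above, the claim is \<open>(1 - b * dens Z) * (x - 1) / \<gamma> < w\<close>, which holds because the covolume factor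
  is at most \<open>1\<close> and \<open>1 / \<gamma> = 1 - 2 * e\<close>, whereas \<open>w = (1 - e) * (x - 1) + 1\<close>.
\<close>
lemma f_wave_less_speed:
  assumes "1 < \<gamma>" "0 \<le> b" "admissible_state b Z" "0 \<le> p"
  shows "f_wave \<gamma> b Z p < sound_speed \<gamma> b Z
    * sqrt (1 + (\<gamma> + 1) / (2 * \<gamma>) * pos_part ((p - pres Z) / pres Z))"
proof (cases "p \<ge> pres Z")
  case True
  define e x where "e = (\<gamma> - 1) / (2 * \<gamma>)" and "x = p / pres Z"
  define c w where "c = 1 - b * dens Z" and "w = (1 - e) * x + e"
  note a = sound_speed_pos[OF assms(1,3)]
  have c: "0 < c" "c \<le> 1" and q: "pres Z > 0"
    using assms by (auto simp: admissible_state_def c_def)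
  have x: "1 \<le> x" using True q by (simp add: x_def)
  have e: "0 < e" "1 / \<gamma> = 1 - 2 * e" using assms(1) by (auto simp: e_def field_simps)
  have w: "w = 1 + (1 - e) * (x - 1)" by (simp add: w_def algebra_simps)
  have "c / \<gamma> * (x - 1) \<le> 1 / \<gamma> * (x - 1)"
    using c x assms(1) by (intro mult_right_mono divide_right_mono) auto
  also have "\<dots> \<le> (1 - e) * (x - 1)"
    unfolding e(2) using x e(1) by (intro mult_right_mono) auto
  also have "\<dots> < w" by (simp add: w)
  finally have lt: "c / \<gamma> * (x - 1) < w" .
  have "0 \<le> c / \<gamma> * (x - 1)" using c x assms(1) by simp
  with lt have w_pos: "w > 0" by linarith
  have "f_wave \<gamma> b Z p = sound_speed \<gamma> b Z * (c / \<gamma> * (x - 1) / sqrt w)"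
    using f_shock_normalized[OF assms(1,3) True] True
    by (simp add: f_wave_def c_def w_def e_def x_def)
  also have "\<dots> < sound_speed \<gamma> b Z * (w / sqrt w)"
    using lt a w_pos by (intro mult_strict_left_mono divide_strict_right_mono) auto
  also have "w / sqrt w = sqrt w" using w_pos by (simp add: real_div_sqrt)
  also have "w = 1 + (\<gamma> + 1) / (2 * \<gamma>) * pos_part ((p - pres Z) / pres Z)"
  proof -
    have "pos_part ((p - pres Z) / pres Z) = x - 1"
      using x q by (simp add: pos_part_def x_def diff_divide_distrib)
    moreover have "1 - e = (\<gamma> + 1) / (2 * \<gamma>)" using assms(1) by (simp add: e_def field_simps)
    ultimately show ?thesis by (simp add: w)
  qed
  finally show ?thesis .
next
  case False
  have "f_wave \<gamma> b Z p < 0"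
    using f_wave_less[OF assms(1,3,4), of "pres Z"] False f_at_pres[OF assms(3)]
    by (simp add: f_wave_def)
  also have "0 < sound_speed \<gamma> b Z
    * sqrt (1 + (\<gamma> + 1) / (2 * \<gamma>) * pos_part ((p - pres Z) / pres Z))"
    using sound_speed_pos[OF assms(1,3)] assms(1)
    by (intro mult_pos_pos) (auto simp: pos_part_def intro!: add_pos_nonneg)
  finally show ?thesis .
qed

lemma relative_speed_mono:
  assumes "1 < \<gamma>" "admissible_state b Z" "p \<le> q"
  shows "sound_speed \<gamma> b Z * sqrt (1 + (\<gamma> + 1) / (2 * \<gamma>) * pos_part ((p - pres Z) / pres Z))
    \<le> sound_speed \<gamma> b Z * sqrt (1 + (\<gamma> + 1) / (2 * \<gamma>) * pos_part ((q - pres Z) / pres Z))"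
proof -
  have "(p - pres Z) / pres Z \<le> (q - pres Z) / pres Z"
    using assms by (intro divide_right_mono) (auto simp: admissible_state_def)
  then have "pos_part ((p - pres Z) / pres Z) \<le> pos_part ((q - pres Z) / pres Z)"
    by (simp add: pos_part_def max_def)
  then show ?thesis
    using assms(1) sound_speed_pos[OF assms(1,2)]
    by (intro mult_left_mono real_sqrt_le_mono add_left_mono) auto
qed

section \<open>The intermediate pressure and the extreme speeds\<close>

lemma p_star_zero:
  assumes "1 < \<gamma>" "admissible_state b L" "admissible_state b R" "phi \<gamma> b L R (p_min L R) < 0"
  shows "p_star \<gamma> b L R > 0" "phi \<gamma> b L R (p_star \<gamma> b L R) = 0"
  using theI'[OF p_star_ex1[OF assms]] unfolding p_star_def by auto

lemma p_tilde_zero: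
  assumes "1 < \<gamma>" "admissible_state b L" "admissible_state b R" "phi \<gamma> b L R (p_min L R) < 0"
  shows "p_tilde \<gamma> b L R \<ge> 0" "phi_R \<gamma> b L R (p_tilde \<gamma> b L R) = 0"
  using theI'[OF p_tilde_ex1[OF assms]] unfolding p_tilde_def by auto

text \<open>The zero of \<open>phi_R\<close> cannot precede that of \<open>phi\<close>, because \<open>phi_R\<close> lies below \<open>phi\<close>.\<close>
lemma p_star_le_p_tilde:
  assumes "1 < \<gamma>" "\<gamma> \<le> 5 / 3" "admissible_state b L" "admissible_state b R"
    and "phi \<gamma> b L R (p_min L R) < 0"
  shows "p_star \<gamma> b L R \<le> p_tilde \<gamma> b L R"
proof (rule ccontr)
  assume "\<not> ?thesis"
  then have "phi_R \<gamma> b L R (p_tilde \<gamma> b L R) < phi_R \<gamma> b L R (p_star \<gamma> b L R)"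
    using p_tilde_zero[OF assms(1,3-5)] by (intro phi_R_less assms) auto
  also have "\<dots> \<le> phi \<gamma> b L R (p_star \<gamma> b L R)"
    using f_rarefaction_le_f_wave[OF assms(1,2,3), of "p_star \<gamma> b L R"]
      f_rarefaction_le_f_wave[OF assms(1,2,4), of "p_star \<gamma> b L R"]
    by (simp add: phi_def phi_R_def)
  finally show False
    using p_star_zero[OF assms(1,3-5)] p_tilde_zero[OF assms(1,3-5)] by simp
qed

lemma p_star_le_of_phi_nonneg:
  assumes "1 < \<gamma>" "admissible_state b L" "admissible_state b R" "phi \<gamma> b L R (p_min L R) < 0"
    and "0 \<le> q" "0 \<le> phi \<gamma> b L R q"
  shows "p_star \<gamma> b L R \<le> q"
proof (rule ccontr)
  assume "\<not> ?thesis"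
  then have "q < p_star \<gamma> b L R" by simp
  then have "phi \<gamma> b L R q < phi \<gamma> b L R (p_star \<gamma> b L R)"
    using f_wave_less[OF assms(1,2,5)] f_wave_less[OF assms(1,3,5)]
    by (simp add: phi_def add_strict_mono)
  then show False using p_star_zero[OF assms(1-4)] assms(6) by simp
qed

lemma lambda_1_minus_less_lambda_3_plus:
  assumes "1 < \<gamma>" "0 \<le> b" "admissible_state b L" "admissible_state b R"
    and "phi \<gamma> b L R (p_min L R) < 0"
  shows "lambda_1_minus \<gamma> b L R < lambda_3_plus \<gamma> b L R"
proof -
  have "0 \<le> p_star \<gamma> b L R" "phi \<gamma> b L R (p_star \<gamma> b L R) = 0"
    using p_star_zero[OF assms(1,3-5)] by auto
  then show ?thesis
    using f_wave_less_speed[OF assms(1-3), of "p_star \<gamma> b L R"]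
      f_wave_less_speed[OF assms(1,2,4), of "p_star \<gamma> b L R"]
    by (simp add: lambda_1_minus_def lambda_3_plus_def speed_1_def speed_3_def phi_def)
qed

theorem mainTheorem4:
  fixes \<gamma> b :: real and L R :: gas_state
  assumes "1 < \<gamma>" and "\<gamma> \<le> 5 / 3" and "0 \<le> b"
    and "admissible_state b L" and "admissible_state b R"
    and "phi \<gamma> b L R (p_min L R) < 0"
    and "phi \<gamma> b L R (p_max L R) \<noteq> 0"
  shows "p_star \<gamma> b L R \<le> p_2_init \<gamma> b L R
    \<and> v_11_init \<gamma> b L R \<le> lambda_1_minus \<gamma> b L R
    \<and> lambda_1_minus \<gamma> b L R < lambda_3_plus \<gamma> b L R
    \<and> lambda_3_plus \<gamma> b L R \<le> v_32_init \<gamma> b L R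
    \<and> lambda_max \<gamma> b L R \<le> max (neg_part (v_11_init \<gamma> b L R)) (pos_part (v_32_init \<gamma> b L R))"
proof -
  have le: "p_star \<gamma> b L R \<le> p_2_init \<gamma> b L R"
  proof (cases "phi \<gamma> b L R (p_max L R) < 0")
    case True
    then show ?thesis using p_star_le_p_tilde assms by (simp add: p_2_init_def)
  next
    case False
    have "0 \<le> p_max L R" using assms(4) by (simp add: p_max_def admissible_state_def le_max_iff_disj)
    then have "p_star \<gamma> b L R \<le> p_max L R"
      using False assms by (intro p_star_le_of_phi_nonneg) auto
    then show ?thesis using False p_star_le_p_tilde assms by (simp add: p_2_init_def)
  qed
  have v1: "v_11_init \<gamma> b L R \<le> lambda_1_minus \<gamma> b L R"
    using relative_speed_mono[OF assms(1,4) le]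
    by (simp add: v_11_init_def lambda_1_minus_def speed_1_def)
  have v3: "lambda_3_plus \<gamma> b L R \<le> v_32_init \<gamma> b L R"
    using relative_speed_mono[OF assms(1,5) le]
    by (simp add: v_32_init_def lambda_3_plus_def speed_3_def)
  have "lambda_max \<gamma> b L R \<le> max (neg_part (v_11_init \<gamma> b L R)) (pos_part (v_32_init \<gamma> b L R))"
    unfolding lambda_max_def neg_part_def pos_part_def using v1 v3
    by (intro max.mono) auto
  then show ?thesis
    using le v1 v3 lambda_1_minus_less_lambda_3_plus[OF assms(1,3-6)] by blast
qed

end
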